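(* Let $m,n\ge 1$, let $f:\mathbb R^m\to\mathbb R$ be differentiable, let $\boldsymbol A:\mathbb R^n\to\mathbb R^m$ and $\boldsymbol x^*\in\mathbb R^n$ be given with $\boldsymbol A(\boldsymbol x^* )\in\mathbb R^m_+$, and let $(\boldsymbol B_\gamma)_\gamma$ be a family of functions $\boldsymbol B_\gamma:\mathbb R^m\to\mathbb R^n$ indexed by a parameter $\gamma$. Suppose that $\boldsymbol b\sim\mathcal P\bigl(\boldsymbol A(\boldsymbol x^* )\bigr)$. Define $\boldsymbol x^\gamma:=\boldsymbol B_\gamma(\boldsymbol b)$ and $$\boldsymbol g_\gamma:=\nabla f\circ\boldsymbol A\circ\boldsymbol B_\gamma:\mathbb R^m\to\mathbb R^m,$$ with components $g_1,\dots,g_m$ (the dependence on $\gamma$ being suppressed), and let $\boldsymbol g_\gamma^{[-1]}:\mathbb R^m\to\mathbb R^m$ be the function whose $i$-th component is $\boldsymbol b\mapsto g_i(\boldsymbol b-\boldsymbol e^i)$, where $\boldsymbol e^i$ is the $i$-th column of the $m\times m$ identity matrix. Assume that $\mathbb E f(\boldsymbol b)<\infty$, that $\mathbb E D_f\bigl(\boldsymbol b,\boldsymbol A(\boldsymbol x^\gamma)\bigr)<\infty$, that $\mathbb E\left[\boldsymbol g_\gamma(\boldsymbol b)^T\boldsymbol b\right]<\infty$, and that for every $i\in\{1,\dots,m\}$, $\mathbb E_{b_i}[g_i(\boldsymbol b)]<\infty$. Then $$\mathbb E D_f\bigl(\boldsymbol A(\boldsymbol x^* ),\boldsymbol A(\boldsymbol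 x^\gamma)\bigr)=K+\mathbb E D_f\bigl(\boldsymbol b,\boldsymbol A(\boldsymbol x^\gamma)\bigr)+\mathbb E\left[\boldsymbol b^T\bigl(\boldsymbol g_\gamma(\boldsymbol b)-\boldsymbol g_\gamma^{[-1]}(\boldsymbol b)\bigr)\right],$$ where $K\in\mathbb R$ is a constant independent of $\gamma$ (that is, the same $K$ works for every $\gamma$ for which the hypotheses hold).
   Context: For a differentiable function $f:\mathbb R^m\to\mathbb R$ (not necessarily convex), the Bregman divergence is $D_f(\boldsymbol x,\boldsymbol y)=f(\boldsymbol x)-f(\boldsymbol y)-\nabla f(\boldsymbol y)^T(\boldsymbol x-\boldsymbol y)$ for $\boldsymbol x,\boldsymbol y\in\mathbb R^m$. $\mathbb R^m_+$ is the set of vectors with nonnegative components. $\boldsymbol b\sim\mathcal P(\boldsymbol\beta)$, for $\boldsymbol\beta\in\mathbb R_+^m$, means that $\boldsymbol b=(b_1,\dots,b_m)$ has independent components with $b_i$ Poisson distributed with mean $\beta_i$ (if $\beta_i=0$ then $b_i=0$ almost surely). $\mathbb E$ is expectation over $\boldsymbol b$ (on which $\boldsymbol x^\gamma$ depends); $\mathbb E_{b_i}$ is expectation over the single component $b_i$, with the other components fixed. Conventions: "$\mathbb E X<\infty$" means that $X$ is integrable, i.e. its expectation exists and is finite; the random variables whose expectations appear in the asserted identity are understood to be integrable. *)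

theory Defs
  imports "HOL-Probability.Probability"
begin

definition gradient :: "('a::real_inner \<Rightarrow> real) \<Rightarrow> 'a \<Rightarrow> 'a" where
  "gradient f x = (THE D. GDERIV f x :> D)"

lemma gradient_eqI:
  assumes "GDERIV f x :> D"
  shows "gradient f x = D"
  unfolding gradient_def
proof (rule the_equality[where P = "\<lambda>D. GDERIV f x :> D", OF assms])
  fix D' assume "GDERIV f x :> D'"
  then have "(\<lambda>h. inner h D') = (\<lambda>h. inner h D)"
    using assms has_derivative_unique unfolding gderiv_def by blast
  then have "inner (D' - D) D' = inner (D' - D) D"
    by metis
  then have "inner (D' - D) (D' - D) = 0"
    by (simp add: inner_diff_right)
  then show "D' = D"
    by simp
qed

lemma GDERIV_gradient:
  fixes f :: "'a::euclidean_space \<Rightarrow> real"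
  assumes "f differentiable (at x)"
  shows "GDERIV f x :> gradient f x"
proof -
  obtain F where F: "(f has_derivative F) (at x)"
    using assms by (auto simp: differentiable_def)
  then have lin: "linear F"
    by (rule has_derivative_linear)
  have "F = (\<lambda>h. inner h (\<Sum>e\<in>Basis. F e *\<^sub>R e))"
  proof
    fix h
    have "F h = F (\<Sum>e\<in>Basis. inner h e *\<^sub>R e)"
      by (simp add: euclidean_representation)
    also have "\<dots> = inner h (\<Sum>e\<in>Basis. F e *\<^sub>R e)"
      by (simp add: linear_sum[OF lin] linear_scale[OF lin] inner_sum_right mult.commute)
    finally show "F h = inner h (\<Sum>e\<in>Basis. F e *\<^sub>R e)" .
  qed
  then have "GDERIV f x :> (\<Sum>e\<in>Basis. F e *\<^sub>R e)"
    using F by (simp add: gderiv_def)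
  then show ?thesis
    using gradient_eqI by metis
qed

definition bregman :: "('a::real_inner \<Rightarrow> real) \<Rightarrow> 'a \<Rightarrow> 'a \<Rightarrow> real" where
  "bregman f x y = f x - f y - gradient f y \<bullet> (x - y)"

(* poisson_pmf is specified only for positive rates; rate 0 is the point mass at 0. *)
definition poisson0_pmf :: "real \<Rightarrow> nat pmf" where
  "poisson0_pmf r = (if r = 0 then return_pmf 0 else poisson_pmf r)"

definition poisson_vector :: "'a measure \<Rightarrow> ('a \<Rightarrow> real ^ 'm) \<Rightarrow> real ^ 'm \<Rightarrow> bool" where
  "poisson_vector M b \<beta> \<longleftrightarrow>
     prob_space.indep_vars M (\<lambda>_. borel) (\<lambda>i \<omega>. b \<omega> $ i) UNIV \<and>
     (\<forall>i. distr M borel (\<lambda>\<omega>. b \<omega> $ i) = distr (poisson0_pmf (\<beta> $ i)) borel real)"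

definition replace_component :: "real ^ 'm \<Rightarrow> 'm \<Rightarrow> real \<Rightarrow> real ^ 'm" where
  "replace_component v i t = (\<chi> j. if j = i then t else v $ j)"

definition shift_down :: "(real ^ 'm \<Rightarrow> real ^ 'm) \<Rightarrow> real ^ 'm \<Rightarrow> real ^ 'm" where
  "shift_down g b = (\<chi> i. g (b - axis i 1) $ i)"

end

theory Submission
  imports Defs
begin

text \<open>The identity reduces to the Stein--Chen relation
  \<open>E[b \<bullet> shift_down g b] = E[g b \<bullet> \<beta>]\<close>. The individual terms \<open>\<beta>\<^sub>i g\<^sub>i(b)\<close> need not be integrable; only
  their sum over \<open>i\<close> is. So the relation is established separately on each event
  \<open>b\<^sub>1 + \<dots> + b\<^sub>m = n\<close>, where only finitely many lattice points occur and the sums over \<open>i\<close> may be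
  split: the recursion \<open>k\<^sub>i p(k) = \<beta>\<^sub>i p(k - e\<^sup>i)\<close> of the Poisson weights equates the left-hand side on
  level \<open>n + 1\<close> with the right-hand side on level \<open>n\<close>. Summing over \<open>n\<close> uses only the integrability of
  the two inner products.\<close>

section \<open>Lattice points, levels and Poisson weights\<close>

definition lattice_point :: "('m \<Rightarrow> nat) \<Rightarrow> real ^ 'm" where
  "lattice_point k = (\<chi> i. real (k i))"

definition level :: "nat \<Rightarrow> ('m::finite \<Rightarrow> nat) set" where
  "level n = {k. sum k UNIV = n}"

definition poisson_weight :: "real ^ 'm \<Rightarrow> ('m \<Rightarrow> nat) \<Rightarrow> real" where
  "poisson_weight \<beta> k = (\<Prod>i\<in>UNIV. pmf (poisson0_pmf (\<beta> $ i)) (k i))"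

lemma lattice_point_nth [simp]: "lattice_point k $ i = real (k i)"
  by (simp add: lattice_point_def)

lemma lattice_point_eq_iff [simp]: "lattice_point k = lattice_point k' \<longleftrightarrow> k = k'"
  by (auto simp: vec_eq_iff)

lemma finite_level: "finite (level n :: ('m::finite \<Rightarrow> nat) set)"
proof (rule finite_subset)
  show "level n \<subseteq> PiE (UNIV :: 'm set) (\<lambda>_. {..n})"
    by (auto simp: level_def member_le_sum)
  show "finite (PiE (UNIV :: 'm set) (\<lambda>_. {..n}))"
    by (intro finite_PiE) auto
qed

lemma lattice_point_fun_upd_Suc:
  "lattice_point (k(i := Suc (k i))) - axis i 1 = lattice_point k"
  by (auto simp: vec_eq_iff axis_def)

text \<open>The factor \<open>Suc k\<close> cancels against the factorial in the Poisson mass. For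
  rate 0 both sides vanish, since the point mass at 0 gives \<open>Suc k\<close> no weight.\<close>

lemma pmf_poisson0_Suc:
  assumes "0 \<le> r"
  shows "real (Suc k) * pmf (poisson0_pmf r) (Suc k) = r * pmf (poisson0_pmf r) k"
  using assms by (auto simp: poisson0_pmf_def simp del: of_nat_Suc)

text \<open>Raising coordinate \<open>i\<close> changes only the factor \<open>i\<close> of the
  product, so the one-dimensional recursion applies. Stepping up with \<open>Suc\<close> keeps
  truncated subtraction out of the recursion.\<close>

lemma poisson_weight_fun_upd_Suc:
  fixes \<beta> :: "real ^ 'm"
  assumes "0 \<le> \<beta> $ i"
  shows "real (Suc (k i)) * poisson_weight \<beta> (k(i := Suc (k i))) = \<beta> $ i * poisson_weight \<beta> k"
proof -
  let ?p = "\<lambda>j. pmf (poisson0_pmf (\<beta> $ j))"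
  have "poisson_weight \<beta> (k(i := Suc (k i))) = ?p i (Suc (k i)) * (\<Prod>j\<in>UNIV - {i}. ?p j (k j))"
    unfolding poisson_weight_def by (subst prod.remove[of _ i]) (auto intro!: prod.cong)
  moreover have "poisson_weight \<beta> k = ?p i (k i) * (\<Prod>j\<in>UNIV - {i}. ?p j (k j))"
    unfolding poisson_weight_def by (subst prod.remove[of _ i]) auto
  ultimately show ?thesis
    using pmf_poisson0_Suc[OF assms, of "k i"] by (metis mult.assoc)
qed

text \<open>The condition \<open>k i \<noteq> 0\<close> is what makes truncated subtraction a
  genuine inverse of the successor in coordinate \<open>i\<close>.\<close>

lemma bij_betw_level_fun_upd_Suc:
  "bij_betw (\<lambda>k. k(i := Suc (k i))) (level n) {k \<in> level (Suc n). k i \<noteq> 0}"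
proof (rule bij_betwI[where g = "\<lambda>k. k(i := k i - 1)"])
  have split: "sum k UNIV = k i + sum k (UNIV - {i})" for k :: "'a \<Rightarrow> nat"
    by (rule sum.remove) auto
  have upd: "sum (k(i := c)) UNIV = c + sum k (UNIV - {i})" for k :: "'a \<Rightarrow> nat" and c
    unfolding split[of "k(i := c)"] by (auto intro!: sum.cong)
  show "(\<lambda>k. k(i := Suc (k i))) \<in> level n \<rightarrow> {k \<in> level (Suc n). k i \<noteq> 0}"
    by (simp add: level_def upd split)
  show "(\<lambda>k. k(i := k i - 1)) \<in> {k \<in> level (Suc n). k i \<noteq> 0} \<rightarrow> level n"
    by (auto simp add: level_def upd split)
qed auto

lemma poisson_weight_level_shift:
  fixes h :: "real ^ 'm \<Rightarrow> real ^ 'm"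
  assumes "\<And>i. 0 \<le> \<beta> $ i"
  shows "(\<Sum>k\<in>level (Suc n). poisson_weight \<beta> k * (lattice_point k \<bullet> shift_down h (lattice_point k))) =
         (\<Sum>k\<in>level n. poisson_weight \<beta> k * (h (lattice_point k) \<bullet> \<beta>))"
proof -
  let ?w = "poisson_weight \<beta>"
  have "(\<Sum>k\<in>level (Suc n). ?w k * (lattice_point k \<bullet> shift_down h (lattice_point k))) =
        (\<Sum>i\<in>UNIV. \<Sum>k\<in>level (Suc n). real (k i) * ?w k * h (lattice_point k - axis i 1) $ i)"
    by (subst sum.swap) (simp add: inner_vec_def shift_down_def sum_distrib_left mult_ac)
  also have "\<dots> = (\<Sum>i\<in>UNIV. \<Sum>k\<in>level n. \<beta> $ i * ?w k * h (lattice_point k) $ i)"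
  proof (rule sum.cong[OF refl])
    fix i :: 'm
    \<comment> \<open>For \<open>k i = 0\<close> the shifted argument has coordinate -1 and leaves
      the lattice; the factor \<open>real (k i)\<close> removes these terms.\<close>
    have "(\<Sum>k\<in>level (Suc n). real (k i) * ?w k * h (lattice_point k - axis i 1) $ i) =
          (\<Sum>k\<in>{k \<in> level (Suc n). k i \<noteq> 0}. real (k i) * ?w k * h (lattice_point k - axis i 1) $ i)"
      by (rule sum.mono_neutral_right) (auto simp: finite_level)
    \<comment> \<open>The substitution that raises coordinate \<open>i\<close> undoes the shift in
      the argument of \<open>h\<close>, while the weight recursion turns the factor
      \<open>k i\<close> into \<beta>\<open>$ i\<close>.\<close>
    also have "\<dots> = (\<Sum>k\<in>level n. \<beta> $ i * ?w k * h (lattice_point k) $ i)"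
      by (subst sum.reindex_bij_betw[OF bij_betw_level_fun_upd_Suc, symmetric])
        (simp add: lattice_point_fun_upd_Suc poisson_weight_fun_upd_Suc assms del: of_nat_Suc)
    finally show "(\<Sum>k\<in>level (Suc n). real (k i) * ?w k * h (lattice_point k - axis i 1) $ i) =
          (\<Sum>k\<in>level n. \<beta> $ i * ?w k * h (lattice_point k) $ i)" .
  qed
  also have "\<dots> = (\<Sum>k\<in>level n. ?w k * (h (lattice_point k) \<bullet> \<beta>))"
    by (subst sum.swap) (simp add: inner_vec_def sum_distrib_left mult_ac)
  finally show ?thesis .
qed

section \<open>Expectations of functions of a Poisson vector\<close>

context
  fixes M :: "'a measure" and b :: "'a \<Rightarrow> real ^ 'm" and \<beta> :: "real ^ 'm"
  assumes prob: "prob_space M" and pois: "poisson_vector M b \<beta>"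
begin

interpretation prob_space M
  by (rule prob)

lemma poisson_vector_measurable: "(\<lambda>\<omega>. b \<omega> $ i) \<in> borel_measurable M"
  using pois by (auto simp: poisson_vector_def indep_vars_def2)

lemma poisson_vector_component_prob:
  assumes "S \<in> sets borel"
  shows "prob ((\<lambda>\<omega>. b \<omega> $ i) -` S \<inter> space M) = measure_pmf.prob (poisson0_pmf (\<beta> $ i)) (real -` S)"
proof -
  have "prob ((\<lambda>\<omega>. b \<omega> $ i) -` S \<inter> space M) = measure (distr M borel (\<lambda>\<omega>. b \<omega> $ i)) S"
    by (rule measure_distr[symmetric]) (use poisson_vector_measurable assms in auto)
  also have "\<dots> = measure (distr (poisson0_pmf (\<beta> $ i)) borel real) S"
    using pois by (simp add: poisson_vector_def)
  also have "\<dots> = measure_pmf.prob (poisson0_pmf (\<beta> $ i)) (real -` S)"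
    using assms by (subst measure_distr) auto
  finally show ?thesis .
qed

lemma poisson_vector_AE_lattice: "AE \<omega> in M. b \<omega> \<in> range lattice_point"
proof -
  have "AE \<omega> in M. b \<omega> $ i \<in> range real" for i
  proof -
    have S: "range real \<in> sets borel"
      by (rule sets.countable) auto
    have "prob ((\<lambda>\<omega>. b \<omega> $ i) -` range real \<inter> space M) = 1"
      unfolding poisson_vector_component_prob[OF S] by (auto simp: measure_pmf.prob_eq_1)
    then have "AE \<omega> in M. \<omega> \<in> (\<lambda>\<omega>. b \<omega> $ i) -` range real \<inter> space M"
      using poisson_vector_measurable S by (subst AE_in_set_eq_1) auto
    then show ?thesis
      by eventually_elim auto
  qed
  then have "AE \<omega> in M. \<forall>i. b \<omega> $ i \<in> range real"
    by (simp add: AE_all_countable)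
  then show ?thesis
  proof eventually_elim
    case (elim \<omega>)
    then obtain k where "\<And>i. b \<omega> $ i = real (k i)"
      unfolding image_iff by metis
    then have "b \<omega> = lattice_point k"
      by (simp add: vec_eq_iff)
    then show ?case
      by simp
  qed
qed

lemma poisson_vector_vimage_eq:
  "{\<omega> \<in> space M. b \<omega> = lattice_point k} = (\<Inter>i\<in>UNIV. (\<lambda>\<omega>. b \<omega> $ i) -` {real (k i)} \<inter> space M)"
  by (auto simp: vec_eq_iff)

lemma poisson_vector_event: "{\<omega> \<in> space M. b \<omega> = lattice_point k} \<in> events"
  unfolding poisson_vector_vimage_eq
  by (intro sets.finite_INT measurable_sets[OF poisson_vector_measurable]) auto

text \<open>Independence factors the probability of the intersection of the coordinate
  events.\<close>

lemma poisson_vector_prob: "prob {\<omega> \<in> space M. b \<omega> = lattice_point k} = poisson_weight \<beta> k"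
proof -
  have "indep_vars (\<lambda>_. borel) (\<lambda>i \<omega>. b \<omega> $ i) UNIV"
    using pois by (simp add: poisson_vector_def)
  then have "prob (\<Inter>i\<in>UNIV. (\<lambda>\<omega>. b \<omega> $ i) -` {real (k i)} \<inter> space M) =
      (\<Prod>i\<in>UNIV. prob ((\<lambda>\<omega>. b \<omega> $ i) -` {real (k i)} \<inter> space M))"
    by (rule indep_varsD_finite) auto
  also have "\<dots> = poisson_weight \<beta> k"
  proof -
    have "real -` {real j} = {j}" for j
      by auto
    then show ?thesis
      by (simp add: poisson_vector_component_prob poisson_weight_def measure_pmf_single)
  qed
  finally show ?thesis
    by (simp add: poisson_vector_vimage_eq)
qed

text \<open>Almost surely \<open>b\<close> is a lattice point, so countable additivity over the
  disjoint level events gives the series. The enumeration \<open>l\<close> may skip levels on which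
  \<phi> vanishes; this flexibility allows a series that starts at level 1.\<close>

lemma poisson_vector_integral_levels:
  assumes int: "integrable M (\<lambda>\<omega>. \<phi> (b \<omega>))"
    and inj: "inj l"
    and cover: "\<And>k. \<phi> (lattice_point k) \<noteq> 0 \<Longrightarrow> sum k UNIV \<in> range l"
  shows "(LINT \<omega>|M. \<phi> (b \<omega>)) =
         (\<Sum>n. \<Sum>k\<in>level (l n). poisson_weight \<beta> k * \<phi> (lattice_point k) :: real)"
proof -
  define E where "E = (\<lambda>k. {\<omega> \<in> space M. b \<omega> = lattice_point k})"
  define F where "F = (\<lambda>n. \<Union>k\<in>level (l n). E k)"
  have E [measurable]: "E k \<in> sets M" for k
    unfolding E_def by (rule poisson_vector_event)
  have F [measurable]: "F n \<in> sets M" for n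
    unfolding F_def by (auto intro: finite_level)
  have disjE: "E k \<inter> E k' = {}" if "k \<noteq> k'" for k k'
    using that by (auto simp: E_def)
  have disjF: "F n \<inter> F n' = {}" if "n \<noteq> n'" for n n'
    using that injD[OF inj, of n n'] by (auto simp: F_def E_def level_def)
  have intS: "set_integrable M S (\<lambda>\<omega>. \<phi> (b \<omega>))" if "S \<in> sets M" for S
    unfolding set_integrable_def using integrable_mult_indicator[OF that int] .
  have "(LINT \<omega>|M. \<phi> (b \<omega>)) = (LINT \<omega>:(\<Union>n. F n)|M. \<phi> (b \<omega>))"
    unfolding set_lebesgue_integral_def
  proof (rule integral_cong_AE)
    show "(\<lambda>\<omega>. \<phi> (b \<omega>)) \<in> borel_measurable M"
      using int by auto
    show "(\<lambda>\<omega>. indicat_real (\<Union>n. F n) \<omega> *\<^sub>R \<phi> (b \<omega>)) \<in> borel_measurable M"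
      using intS[of "\<Union>n. F n"] by (auto simp: set_integrable_def)
    \<comment> \<open>Almost every point outside all \<open>F n\<close> is sent to a lattice point
      on a level missed by \<open>l\<close>, where \<phi> is zero by \<open>cover\<close>.\<close>
    show "AE \<omega> in M. \<phi> (b \<omega>) = indicat_real (\<Union>n. F n) \<omega> *\<^sub>R \<phi> (b \<omega>)"
      using poisson_vector_AE_lattice AE_space
    proof eventually_elim
      case (elim \<omega>)
      then obtain k where k: "b \<omega> = lattice_point k"
        by auto
      show ?case
      proof (cases "\<phi> (b \<omega>) = 0")
        case False
        then obtain n where "sum k UNIV = l n"
          using cover[of k] k by auto
        then have "\<omega> \<in> F n"
          using elim k by (auto simp: F_def E_def level_def)
        then show ?thesis
          by (auto simp: indicator_def)
      qed simp
    qed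
  qed
  also have "\<dots> = (\<Sum>n. LINT \<omega>:F n|M. \<phi> (b \<omega>))"
    by (rule lebesgue_integral_countable_add) (use disjF intS in auto)
  also have "(\<lambda>n. LINT \<omega>:F n|M. \<phi> (b \<omega>)) =
      (\<lambda>n. \<Sum>k\<in>level (l n). poisson_weight \<beta> k * \<phi> (lattice_point k))"
  proof
    fix n
    have "(LINT \<omega>:F n|M. \<phi> (b \<omega>)) = (\<Sum>k\<in>level (l n). LINT \<omega>:E k|M. \<phi> (b \<omega>))"
      unfolding F_def
      by (rule set_integral_finite_Union)
        (use disjE intS in \<open>auto simp: finite_level disjoint_family_on_def\<close>)
    also have "\<dots> = (\<Sum>k\<in>level (l n). poisson_weight \<beta> k * \<phi> (lattice_point k))"
    proof (rule sum.cong[OF refl])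
      fix k
      have "(LINT \<omega>:E k|M. \<phi> (b \<omega>)) = (LINT \<omega>:E k|M. \<phi> (lattice_point k))"
        by (rule set_lebesgue_integral_cong[OF E]) (auto simp: E_def)
      also have "\<dots> = prob (E k) * \<phi> (lattice_point k)"
        by (simp add: set_lebesgue_integral_def)
      finally show "(LINT \<omega>:E k|M. \<phi> (b \<omega>)) = poisson_weight \<beta> k * \<phi> (lattice_point k)"
        by (simp add: E_def poisson_vector_prob)
    qed
    finally show "(LINT \<omega>:F n|M. \<phi> (b \<omega>)) =
        (\<Sum>k\<in>level (l n). poisson_weight \<beta> k * \<phi> (lattice_point k))" .
  qed
  finally show ?thesis .
qed

lemma stein_chen_vector:
  assumes nonneg: "\<And>i. 0 \<le> \<beta> $ i"
    and int_shift: "integrable M (\<lambda>\<omega>. b \<omega> \<bullet> shift_down h (b \<omega>))"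
    and int: "integrable M (\<lambda>\<omega>. h (b \<omega>) \<bullet> \<beta>)"
  shows "(LINT \<omega>|M. b \<omega> \<bullet> shift_down h (b \<omega>)) = (LINT \<omega>|M. h (b \<omega>) \<bullet> \<beta>)"
proof -
  \<comment> \<open>Level 0 contains only the zero vector, whose inner product with anything is 0.
    Hence the left-hand series can be indexed by \<open>Suc\<close>.\<close>
  have "sum k UNIV \<in> range Suc"
    if "lattice_point k \<bullet> shift_down h (lattice_point k) \<noteq> 0" for k :: "'m \<Rightarrow> nat"
  proof -
    have "sum k UNIV \<noteq> 0"
    proof
      assume "sum k UNIV = 0"
      then have "lattice_point k = 0"
        by (simp add: vec_eq_iff)
      then show False
        using that by simp
    qed
    then show ?thesis
      by (metis not0_implies_Suc rangeI)
  qed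
  then have "(LINT \<omega>|M. b \<omega> \<bullet> shift_down h (b \<omega>)) = (\<Sum>n. \<Sum>k\<in>level (Suc n).
      poisson_weight \<beta> k * (lattice_point k \<bullet> shift_down h (lattice_point k)))"
    using poisson_vector_integral_levels[where \<phi> = "\<lambda>v. v \<bullet> shift_down h v" and l = Suc] int_shift
    by auto
  \<comment> \<open>The two series agree term by term in \<open>n\<close>, so nothing is rearranged
    across levels.\<close>
  also have "\<dots> = (\<Sum>n. \<Sum>k\<in>level n. poisson_weight \<beta> k * (h (lattice_point k) \<bullet> \<beta>))"
    by (simp add: poisson_weight_level_shift nonneg)
  also have "\<dots> = (LINT \<omega>|M. h (b \<omega>) \<bullet> \<beta>)"
    using poisson_vector_integral_levels[where \<phi> = "\<lambda>v. h v \<bullet> \<beta>" and l = "\<lambda>n. n"] int by auto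
  finally show ?thesis .
qed

end

section \<open>The identity for Bregman divergences\<close>

theorem proposition2:
  fixes M :: "'a measure"
    and f :: "real ^ 'm \<Rightarrow> real"
    and A :: "real ^ 'n \<Rightarrow> real ^ 'm"
    and xstar :: "real ^ 'n"
    and B :: "'g \<Rightarrow> real ^ 'm \<Rightarrow> real ^ 'n"
    and b :: "'a \<Rightarrow> real ^ 'm"
    and g :: "'g \<Rightarrow> real ^ 'm \<Rightarrow> real ^ 'm"
  assumes "prob_space M"
    and "\<forall>x. f differentiable (at x)"
    and "\<forall>i. 0 \<le> A xstar $ i"
    and "poisson_vector M b (A xstar)"
    and g_def: "\<And>\<gamma>. g \<gamma> = gradient f \<circ> A \<circ> B \<gamma>"
    and "integrable M (\<lambda>\<omega>. f (b \<omega>))"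
  shows "\<exists>K::real. \<forall>\<gamma>.
     integrable M (\<lambda>\<omega>. bregman f (b \<omega>) (A (B \<gamma> (b \<omega>)))) \<longrightarrow>
     integrable M (\<lambda>\<omega>. g \<gamma> (b \<omega>) \<bullet> b \<omega>) \<longrightarrow>
     (\<forall>i. AE \<omega> in M. integrable (measure_pmf (poisson0_pmf (A xstar $ i)))
            (\<lambda>k. g \<gamma> (replace_component (b \<omega>) i (real k)) $ i)) \<longrightarrow>
     integrable M (\<lambda>\<omega>. bregman f (A xstar) (A (B \<gamma> (b \<omega>)))) \<longrightarrow>
     integrable M (\<lambda>\<omega>. b \<omega> \<bullet> (g \<gamma> (b \<omega>) - shift_down (g \<gamma>) (b \<omega>))) \<longrightarrow>
     (LINT \<omega>|M. bregman f (A xstar) (A (B \<gamma> (b \<omega>)))) =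
       K + (LINT \<omega>|M. bregman f (b \<omega>) (A (B \<gamma> (b \<omega>)))) +
       (LINT \<omega>|M. b \<omega> \<bullet> (g \<gamma> (b \<omega>) - shift_down (g \<gamma>) (b \<omega>)))"
proof (intro exI allI impI)
  fix \<gamma>
  let ?\<beta> = "A xstar" and ?y = "\<lambda>\<omega>. A (B \<gamma> (b \<omega>))"
  let ?h = "g \<gamma>"
  assume int_Db: "integrable M (\<lambda>\<omega>. bregman f (b \<omega>) (?y \<omega>))"
    and int_gb: "integrable M (\<lambda>\<omega>. ?h (b \<omega>) \<bullet> b \<omega>)"
    and int_D\<beta>: "integrable M (\<lambda>\<omega>. bregman f ?\<beta> (?y \<omega>))"
    and int_diff: "integrable M (\<lambda>\<omega>. b \<omega> \<bullet> (?h (b \<omega>) - shift_down ?h (b \<omega>)))"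
  interpret prob_space M
    by fact
  \<comment> \<open>Both divergences have the same second argument, so its value under
    \<open>f\<close> cancels in their difference and only an inner product with the gradient
    remains.\<close>
  have D: "bregman f ?\<beta> (?y \<omega>) =
      f ?\<beta> - f (b \<omega>) + bregman f (b \<omega>) (?y \<omega>) + ?h (b \<omega>) \<bullet> b \<omega> - ?h (b \<omega>) \<bullet> ?\<beta>" for \<omega>
    by (simp add: bregman_def g_def inner_diff_right)
  \<comment> \<open>Solving \<open>D\<close> for this inner product exhibits it as a combination of
    integrable functions; this yields integrability of the whole sum over the coordinates.\<close>
  have "(\<lambda>\<omega>. ?h (b \<omega>) \<bullet> ?\<beta>) = (\<lambda>\<omega>. f ?\<beta> - f (b \<omega>) + bregman f (b \<omega>) (?y \<omega>)
      + ?h (b \<omega>) \<bullet> b \<omega> - bregman f ?\<beta> (?y \<omega>))"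
    by (simp add: D)
  then have int_g\<beta>: "integrable M (\<lambda>\<omega>. ?h (b \<omega>) \<bullet> ?\<beta>)"
    using assms(6) int_Db int_gb int_D\<beta> by simp
  have "(\<lambda>\<omega>. b \<omega> \<bullet> shift_down ?h (b \<omega>)) =
      (\<lambda>\<omega>. ?h (b \<omega>) \<bullet> b \<omega> - b \<omega> \<bullet> (?h (b \<omega>) - shift_down ?h (b \<omega>)))"
    by (simp add: inner_diff_right inner_commute)
  then have int_shift: "integrable M (\<lambda>\<omega>. b \<omega> \<bullet> shift_down ?h (b \<omega>))"
    using int_gb int_diff by simp
  have "(LINT \<omega>|M. b \<omega> \<bullet> (?h (b \<omega>) - shift_down ?h (b \<omega>))) =
      (LINT \<omega>|M. ?h (b \<omega>) \<bullet> b \<omega>) - (LINT \<omega>|M. b \<omega> \<bullet> shift_down ?h (b \<omega>))"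
    using int_gb int_shift by (simp add: inner_diff_right inner_commute)
  also have "(LINT \<omega>|M. b \<omega> \<bullet> shift_down ?h (b \<omega>)) = (LINT \<omega>|M. ?h (b \<omega>) \<bullet> ?\<beta>)"
    using assms(1,3,4) int_shift int_g\<beta> by (intro stein_chen_vector) auto
  \<comment> \<open>The witness \<open>K\<close> is fixed here as the value of \<open>f\<close> at
    the mean minus the expectation of \<open>f (b \<omega>)\<close>; neither term involves
    \<gamma>.\<close>
  finally show "(LINT \<omega>|M. bregman f ?\<beta> (?y \<omega>)) =
      (f ?\<beta> - (LINT \<omega>|M. f (b \<omega>))) + (LINT \<omega>|M. bregman f (b \<omega>) (?y \<omega>)) +
      (LINT \<omega>|M. b \<omega> \<bullet> (?h (b \<omega>) - shift_down ?h (b \<omega>)))"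
    using assms(6) int_Db int_gb int_g\<beta> by (simp add: D prob_space)
qed

end
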